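(* Let $X$ be a locally solid $f$-ring that possesses the $AM$-property and the Levi property, and let $Y$ be any locally solid $\ell$-ring. Then every order bounded group homomorphism $T:X\to Y$ (of the additive groups) is $br$-bounded.
   Context: An $\ell$-ring (lattice ring) is a ring which is also a lattice, the additive group being a lattice-ordered group, with $|x\cdot y|\le |x|\cdot|y|$ for all $x,y$. $X_+=\{x\in X: x\ge 0\}$. A set $S\subseteq X$ is solid if $x\in X$, $y\in S$, $|x|\le|y|$ imply $x\in S$. A locally solid $\ell$-ring is an $\ell$-ring that is also a topological ring and has a local basis at zero consisting of solid sets. An $f$-ring is an $\ell$-ring in which $a\wedge b=0$ and $c>0$ imply $ca\wedge b=ac\wedge b=0$; a locally solid $f$-ring is a locally solid $\ell$-ring that is an $f$-ring. Archimedean: $nx\le y$ for all $n\in\mathbb N$ implies $x\le 0$. A set $B$ in a topological ring is bounded if for each zero neighborhood $W$ there is a zero neighborhood $V$ with $VB\subseteq W$ and $BV\subseteq W$ (sets of products). A set is order bounded if it is contained in some order interval $[u,v]$. For $B\subseteq X$, $B^{\vee}=\{b_1\vee\dots\vee b_n: n\in\mathbb N,\ b_i\in B\}$. An Archimedean locally solid $\ell$-ring has the $AM$-property if $B^{\vee}$ is bounded for every bounded set $B$. A locally solid $\ell$-ring has the Levi property if every bounded upward directed set of positive elements has a supremum. A group homomorphism $T:X\to Y$ is $br$-bounded if $T(B)$ is bounded in $Y$ for every bounded $B\subseteq X$; order bounded if $T$ maps order bounded sets to order bounded sets. Standing assumption: in every topological group considered (including the additive groups of topological rings), singletons are bounded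 in the group sense: for each $x$ and each neighborhood $U$ of the identity there is a positive integer $n$ with $x\in nU=\{x_1+\dots+x_n: x_i\in U\}$. *)

theory Defs
  imports "HOL-Library.Lattice_Algebras" "HOL-Library.Lub_Glb"
begin

text \<open>
  The class \<^class>\<open>lattice_ring\<close> (associative, not necessarily unital or commutative) requires
  multiplication by nonnegative elements to be monotone. This is equivalent to
  \<open>\<bar>x * y\<bar> \<le> \<bar>x\<bar> * \<bar>y\<bar>\<close>: one direction is the library's \<open>abs_le_mult\<close>, the other is the following.
\<close>

lemma abs_le_mult_imp_mult_mono:
  fixes a b c :: "'a::{ring,lattice_ab_group_add_abs}"
  assumes "\<And>x y :: 'a. \<bar>x * y\<bar> \<le> \<bar>x\<bar> * \<bar>y\<bar>" and "a \<le> b" and "0 \<le> c"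
  shows "c * a \<le> c * b" and "a * c \<le> b * c"
proof -
  have nonneg: "0 \<le> x * y" if "0 \<le> x" "0 \<le> y" for x y :: 'a
    using assms(1)[of x y] that by (metis abs_ge_zero abs_of_nonneg order_trans)
  show "c * a \<le> c * b"
    using nonneg[of c "b - a"] assms(2,3) by (simp add: right_diff_distrib)
  show "a * c \<le> b * c"
    using nonneg[of "b - a" c] assms(2,3) by (simp add: left_diff_distrib)
qed

context lattice_ab_group_add_abs
begin

definition solid :: "'a set \<Rightarrow> bool"
  where "solid S \<longleftrightarrow> (\<forall>x. \<forall>y\<in>S. \<bar>x\<bar> \<le> \<bar>y\<bar> \<longrightarrow> x \<in> S)"

end

text \<open>
  Throughout, a zero neighborhood \<open>U\<close> is expressed by \<open>\<forall>\<^sub>F x in nhds 0. x \<in> U\<close>; it need not be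
  open. No separation axiom is imposed.
\<close>

class locally_solid_lattice_ring =
  lattice_ring + topological_ab_group_add + topological_semigroup_mult +
  assumes solid_local_basis:
    "(\<forall>\<^sub>F x in nhds 0. x \<in> U) \<Longrightarrow> \<exists>V. solid V \<and> (\<forall>\<^sub>F x in nhds 0. x \<in> V) \<and> V \<subseteq> U"

class f_ring = lattice_ring +
  assumes inf_mult_left_eq_0: "inf a b = 0 \<Longrightarrow> 0 < c \<Longrightarrow> inf (c * a) b = 0"
    and inf_mult_right_eq_0: "inf a b = 0 \<Longrightarrow> 0 < c \<Longrightarrow> inf (a * c) b = 0"

class locally_solid_f_ring = locally_solid_lattice_ring + f_ring

text \<open>The sum \<open>\<Sum>i<n. x\<close> is the \<open>n\<close>-fold multiple of \<open>x\<close>; there need not be a unit.\<close>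

definition archimedean :: "'a::lattice_ring itself \<Rightarrow> bool"
  where "archimedean _ \<longleftrightarrow> (\<forall>x y :: 'a. (\<forall>n>0. (\<Sum>i<n::nat. x) \<le> y) \<longrightarrow> x \<le> 0)"

definition ring_bounded :: "'a::{ring,topological_space} set \<Rightarrow> bool"
  where "ring_bounded B \<longleftrightarrow>
    (\<forall>W. (\<forall>\<^sub>F x in nhds 0. x \<in> W) \<longrightarrow>
      (\<exists>V. (\<forall>\<^sub>F x in nhds 0. x \<in> V) \<and> (\<forall>v\<in>V. \<forall>b\<in>B. v * b \<in> W \<and> b * v \<in> W)))"

definition order_bounded :: "'a::order set \<Rightarrow> bool"
  where "order_bounded B \<longleftrightarrow> (\<exists>u v. B \<subseteq> {u..v})"

definition finite_sups :: "'a::lattice set \<Rightarrow> 'a set"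
  where "finite_sups B = {Sup_fin F | F. finite F \<and> F \<noteq> {} \<and> F \<subseteq> B}"

definition AM_property :: "'a::locally_solid_lattice_ring itself \<Rightarrow> bool"
  where "AM_property _ \<longleftrightarrow>
    archimedean TYPE('a) \<and> (\<forall>B :: 'a set. ring_bounded B \<longrightarrow> ring_bounded (finite_sups B))"

text \<open>
  Directed sets are nonempty; otherwise the empty set would force a least element in the
  following definition.
\<close>

definition upward_directed :: "'a::order set \<Rightarrow> bool"
  where "upward_directed D \<longleftrightarrow> D \<noteq> {} \<and> (\<forall>x\<in>D. \<forall>y\<in>D. \<exists>z\<in>D. x \<le> z \<and> y \<le> z)"

definition Levi_property :: "'a::locally_solid_lattice_ring itself \<Rightarrow> bool"
  where "Levi_property _ \<longleftrightarrow>
    (\<forall>D :: 'a set. ring_bounded D \<longrightarrow> upward_directed D \<longrightarrow> (\<forall>x\<in>D. 0 \<le> x) \<longrightarrow>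
      (\<exists>s. isLub UNIV D s))"

definition br_bounded ::
    "('a::{ring,topological_space} \<Rightarrow> 'b::{ring,topological_space}) \<Rightarrow> bool"
  where "br_bounded T \<longleftrightarrow> (\<forall>B. ring_bounded B \<longrightarrow> ring_bounded (T ` B))"

definition order_bounded_map :: "('a::order \<Rightarrow> 'b::order) \<Rightarrow> bool"
  where "order_bounded_map T \<longleftrightarrow> (\<forall>B. order_bounded B \<longrightarrow> order_bounded (T ` B))"

text \<open>\<open>n\<close>-fold sumset: sums of \<open>n\<close> possibly different elements of \<open>U\<close>, not multiples of one element.\<close>

definition nfold_sums :: "nat \<Rightarrow> 'a::comm_monoid_add set \<Rightarrow> 'a set"
  where "nfold_sums n U = {\<Sum>i<n. f i | f. \<forall>i<n. f i \<in> U}"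

definition singletons_group_bounded :: "'a::topological_ab_group_add itself \<Rightarrow> bool"
  where "singletons_group_bounded _ \<longleftrightarrow>
    (\<forall>(x::'a) U. (\<forall>\<^sub>F y in nhds 0. y \<in> U) \<longrightarrow> (\<exists>n>0. x \<in> nfold_sums n U))"

end

theory Submission
  imports Defs
begin

text \<open>
  The point is that under the hypotheses on the domain a bounded set \<open>B\<close> is order bounded. In an
  \<open>f\<close>-ring \<open>\<bar>c * b\<bar> = c * \<bar>b\<bar>\<close> for \<open>0 \<le> c\<close>, so the set of absolute values of \<open>B\<close> is again bounded;
  by the \<open>AM\<close>-property so is the upward directed set of its finite suprema, and by the Levi property
  that set has a supremum \<open>s\<close>. Hence \<open>B\<close> lies in the order interval from \<open>- s\<close> to \<open>s\<close>, and \<open>T\<close> maps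
  it into an order interval of the codomain. There order bounded sets are bounded, because singletons
  are bounded by continuity of the multiplication, and solid neighborhoods pass this on from
  \<open>{a}\<close> to everything dominated by \<open>a\<close>.
\<close>

lemma inf_pprt_uminus_nprt:
  fixes x :: "'a::lattice_ab_group_add"
  shows "inf (pprt x) (- nprt x) = 0"
proof -
  have "inf x 0 + - nprt x = inf (x + - nprt x) (0 + - nprt x)"
    by (rule add_inf_distrib_right)
  moreover have "x + - nprt x = pprt x"
    using prts[of x] by (simp add: algebra_simps)
  moreover have "inf x 0 + - nprt x = 0"
    by (simp only: nprt_def add.right_inverse)
  ultimately show ?thesis
    by (simp only: add_0_left)
qed

lemma abs_diff_disjoint:
  fixes x y :: "'a::lattice_ab_group_add_abs"
  assumes "inf x y = 0"
  shows "\<bar>x - y\<bar> = x + y"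
proof -
  have "inf x y - y = nprt (x - y)"
    by (simp only: nprt_def diff_conv_add_uminus add_inf_distrib_right add.right_inverse)
  then have "nprt (x - y) = - y"
    using assms by simp
  moreover from this have "pprt (x - y) = x"
    using prts[of "x - y"] by (simp add: algebra_simps)
  ultimately show ?thesis
    by (simp add: abs_prts)
qed

text \<open>
  The positive and the negative part of \<open>x\<close> are disjoint, and the \<open>f\<close>-ring axiom, used once for
  each of them, keeps them disjoint after multiplication by \<open>c\<close>.
\<close>

lemma f_ring_abs_mult_nonneg:
  fixes c x :: "'a::f_ring"
  assumes "0 \<le> c"
  shows "\<bar>c * x\<bar> = c * \<bar>x\<bar>" and "\<bar>x * c\<bar> = \<bar>x\<bar> * c"
proof -
  define p n where "p = pprt x" and "n = - nprt x"
  have x: "x = p - n" and abs_x: "\<bar>x\<bar> = p + n" and disj: "inf p n = 0"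
    using prts[of x] abs_prts[of x] inf_pprt_uminus_nprt[of x] by (simp_all add: p_def n_def)
  have "inf (c * p) (c * n) = 0 \<and> inf (p * c) (n * c) = 0"
  proof (cases "c = 0")
    case False
    with assms have "0 < c" by simp
    with disj show ?thesis
      by (metis inf.commute inf_mult_left_eq_0 inf_mult_right_eq_0)
  qed simp
  then show "\<bar>c * x\<bar> = c * \<bar>x\<bar>" "\<bar>x * c\<bar> = \<bar>x\<bar> * c"
    unfolding abs_x unfolding x
    by (simp_all add: algebra_simps abs_diff_disjoint)
qed

lemma solidD:
  fixes S :: "'a::lattice_ab_group_add_abs set"
  shows "solid S \<Longrightarrow> y \<in> S \<Longrightarrow> \<bar>x\<bar> \<le> \<bar>y\<bar> \<Longrightarrow> x \<in> S"
  unfolding solid_def by blast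

text \<open>
  Comparing the products with nonnegative multipliers \<open>c\<close> is enough, because a solid neighborhood
  contains \<open>\<bar>v\<bar>\<close> along with \<open>v\<close>, and \<open>\<bar>v * y\<bar> \<le> \<bar>v\<bar> * \<bar>y\<bar>\<close>. The absolute value is taken of the
  product \<open>c * b\<close>, not of \<open>b\<close>: boundedness of the set of all \<open>b\<close> makes \<open>c * b\<close> small, whereas
  \<open>c * \<bar>b\<bar>\<close> may be larger outside \<open>f\<close>-rings.
\<close>

lemma ring_bounded_dominated:
  fixes B C :: "'a::locally_solid_lattice_ring set"
  assumes "ring_bounded B"
    and dom: "\<And>y. y \<in> C \<Longrightarrow> \<exists>b\<in>B. \<forall>c\<ge>0. c * \<bar>y\<bar> \<le> \<bar>c * b\<bar> \<and> \<bar>y\<bar> * c \<le> \<bar>b * c\<bar>"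
  shows "ring_bounded C"
  unfolding ring_bounded_def
proof (intro allI impI)
  fix U :: "'a set"
  assume "\<forall>\<^sub>F x in nhds 0. x \<in> U"
  then obtain W where W: "solid W" "\<forall>\<^sub>F x in nhds 0. x \<in> W" "W \<subseteq> U"
    using solid_local_basis by blast
  with assms(1) obtain V' where
    V': "\<forall>\<^sub>F x in nhds 0. x \<in> V'" "\<forall>v\<in>V'. \<forall>b\<in>B. v * b \<in> W \<and> b * v \<in> W"
    unfolding ring_bounded_def by blast
  obtain V where V: "solid V" "\<forall>\<^sub>F x in nhds 0. x \<in> V" "V \<subseteq> V'"
    using solid_local_basis[OF V'(1)] by blast
  have "v * y \<in> U \<and> y * v \<in> U" if "v \<in> V" "y \<in> C" for v y
  proof -
    obtain b where b: "b \<in> B"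
      and le: "\<bar>v\<bar> * \<bar>y\<bar> \<le> \<bar>\<bar>v\<bar> * b\<bar>" "\<bar>y\<bar> * \<bar>v\<bar> \<le> \<bar>b * \<bar>v\<bar>\<bar>"
      using dom[OF \<open>y \<in> C\<close>] by (meson abs_ge_zero)
    have "\<bar>v\<bar> \<in> V'"
      using solidD[OF V(1) \<open>v \<in> V\<close>, of "\<bar>v\<bar>"] V(3) by auto
    then have "\<bar>v\<bar> * b \<in> W" "b * \<bar>v\<bar> \<in> W"
      using V'(2) b by blast+
    moreover have "\<bar>v * y\<bar> \<le> \<bar>\<bar>v\<bar> * b\<bar>" "\<bar>y * v\<bar> \<le> \<bar>b * \<bar>v\<bar>\<bar>"
      using le abs_le_mult order_trans by blast+
    ultimately show ?thesis
      using solidD[OF W(1)] W(3) by blast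
  qed
  with V(2) show "\<exists>V. (\<forall>\<^sub>F x in nhds 0. x \<in> V) \<and> (\<forall>v\<in>V. \<forall>y\<in>C. v * y \<in> U \<and> y * v \<in> U)"
    by blast
qed

lemma ring_bounded_abs_image:
  fixes B :: "'a::locally_solid_f_ring set"
  assumes "ring_bounded B"
  shows "ring_bounded (abs ` B)"
  using assms
proof (rule ring_bounded_dominated)
  fix y
  assume "y \<in> abs ` B"
  then show "\<exists>b\<in>B. \<forall>c\<ge>0. c * \<bar>y\<bar> \<le> \<bar>c * b\<bar> \<and> \<bar>y\<bar> * c \<le> \<bar>b * c\<bar>"
    by (auto simp: f_ring_abs_mult_nonneg)
qed

lemma ring_bounded_singleton:
  fixes a :: "'a::{ring,topological_ab_group_add,topological_semigroup_mult}"
  shows "ring_bounded {a}"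
  unfolding ring_bounded_def
proof (intro allI impI)
  fix W :: "'a set"
  assume W: "\<forall>\<^sub>F x in nhds 0. x \<in> W"
  have id: "((\<lambda>v::'a. v) \<longlongrightarrow> 0) (nhds 0)"
    by (rule filterlim_ident)
  have "((\<lambda>v. v * a) \<longlongrightarrow> 0) (nhds 0)" "((\<lambda>v. a * v) \<longlongrightarrow> 0) (nhds 0)"
    using tendsto_mult[OF id tendsto_const[of a]] tendsto_mult[OF tendsto_const[of a] id]
    by simp_all
  then have "\<forall>\<^sub>F v in nhds 0. v * a \<in> W" "\<forall>\<^sub>F v in nhds 0. a * v \<in> W"
    using W unfolding filterlim_iff by blast+
  then have "\<forall>\<^sub>F v in nhds 0. v \<in> {v. v * a \<in> W \<and> a * v \<in> W}"
    by (simp add: eventually_conj)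
  then show "\<exists>V. (\<forall>\<^sub>F x in nhds 0. x \<in> V) \<and> (\<forall>v\<in>V. \<forall>b\<in>{a}. v * b \<in> W \<and> b * v \<in> W)"
    by blast
qed

lemma order_bounded_imp_ring_bounded:
  fixes B :: "'a::locally_solid_lattice_ring set"
  assumes "order_bounded B"
  shows "ring_bounded B"
proof -
  obtain u v where uv: "B \<subseteq> {u..v}"
    using assms unfolding order_bounded_def by blast
  define a where "a = \<bar>u\<bar> + \<bar>v\<bar>"
  have "0 \<le> a"
    by (simp add: a_def)
  have abs_le: "\<bar>y\<bar> \<le> a" if "y \<in> B" for y
  proof (rule abs_leI)
    have "v \<le> \<bar>v\<bar>" "- u \<le> \<bar>u\<bar>"
      by (simp_all add: abs_ge_self abs_ge_minus_self)
    then have va: "v \<le> a" and ua: "- u \<le> a"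
      unfolding a_def using abs_ge_zero[of u] abs_ge_zero[of v]
      by (simp_all add: add_increasing add_increasing2)
    from that uv have "u \<le> y" "y \<le> v" by auto
    with va ua show "y \<le> a" "- y \<le> a"
      by (meson neg_le_iff_le order_trans)+
  qed
  show ?thesis
  proof (rule ring_bounded_dominated[OF ring_bounded_singleton])
    fix y
    assume "y \<in> B"
    have "c * \<bar>y\<bar> \<le> \<bar>c * a\<bar>" "\<bar>y\<bar> * c \<le> \<bar>a * c\<bar>" if "0 \<le> c" for c
      using mult_left_mono[OF abs_le[OF \<open>y \<in> B\<close>] that] mult_right_mono[OF abs_le[OF \<open>y \<in> B\<close>] that]
      by (meson abs_ge_self order_trans)+
    then show "\<exists>b\<in>{a}. \<forall>c\<ge>0. c * \<bar>y\<bar> \<le> \<bar>c * b\<bar> \<and> \<bar>y\<bar> * c \<le> \<bar>b * c\<bar>"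
      by blast
  qed
qed

lemma subset_finite_sups: "B \<subseteq> finite_sups B"
proof
  fix b assume "b \<in> B"
  then show "b \<in> finite_sups B"
    unfolding finite_sups_def by (intro CollectI exI[of _ "{b}"]) simp
qed

lemma upward_directed_finite_sups:
  fixes B :: "'a::lattice set"
  assumes "B \<noteq> {}"
  shows "upward_directed (finite_sups B)"
proof -
  have "\<exists>z\<in>finite_sups B. x \<le> z \<and> y \<le> z" if xy: "x \<in> finite_sups B" "y \<in> finite_sups B" for x y
  proof -
    obtain F G where F: "finite F" "F \<noteq> {}" "F \<subseteq> B" "x = Sup_fin F"
      and G: "finite G" "G \<noteq> {}" "G \<subseteq> B" "y = Sup_fin G"
      using xy unfolding finite_sups_def by blast
    then have "Sup_fin (F \<union> G) \<in> finite_sups B"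
      unfolding finite_sups_def by blast
    moreover have "Sup_fin (F \<union> G) = sup x y"
      using F G by (simp add: Sup_fin.union)
    ultimately show ?thesis
      by (metis sup_ge1 sup_ge2)
  qed
  with assms subset_finite_sups[of B] show ?thesis
    unfolding upward_directed_def by blast
qed

lemma finite_sups_nonneg:
  fixes B :: "'a::{lattice,zero} set"
  assumes "\<And>b. b \<in> B \<Longrightarrow> 0 \<le> b" and "x \<in> finite_sups B"
  shows "0 \<le> x"
proof -
  obtain F b where F: "finite F" "F \<subseteq> B" "x = Sup_fin F" "b \<in> F"
    using assms(2) unfolding finite_sups_def by blast
  then have "b \<le> x"
    using Sup_fin.coboundedI by blast
  with F assms(1) show ?thesis
    using order_trans by blast
qed

text \<open>
  Finite suprema of absolute values are taken because the Levi property yields suprema only for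
  upward directed sets of positive elements. The empty set is treated apart, as it has no finite
  suprema and directed sets are nonempty.
\<close>

lemma ring_bounded_imp_order_bounded:
  fixes B :: "'a::locally_solid_f_ring set"
  assumes AM: "AM_property TYPE('a)" and Levi: "Levi_property TYPE('a)" and B: "ring_bounded B"
  shows "order_bounded B"
proof (cases "B = {}")
  case False
  let ?D = "finite_sups (abs ` B)"
  have "ring_bounded ?D"
    using AM ring_bounded_abs_image[OF B] unfolding AM_property_def by blast
  moreover have "upward_directed ?D"
    using False by (simp add: upward_directed_finite_sups)
  moreover have "\<forall>x\<in>?D. 0 \<le> x"
  proof
    fix x
    assume "x \<in> ?D"
    then show "0 \<le> x"
      by (rule finite_sups_nonneg[rotated]) auto
  qed
  ultimately obtain s where "isLub UNIV ?D s"
    using Levi unfolding Levi_property_def by blast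
  then have "\<bar>b\<bar> \<le> s" if "b \<in> B" for b
    using that subset_finite_sups[of "abs ` B"] by (blast dest: isLubD2)
  then have "B \<subseteq> {- s..s}"
    by (meson abs_le_D1 abs_le_D2 atLeastAtMost_iff minus_le_iff subsetI)
  then show ?thesis
    unfolding order_bounded_def by blast
qed (simp add: order_bounded_def)

theorem proposition6:
  fixes T :: "'a::locally_solid_f_ring \<Rightarrow> 'b::locally_solid_lattice_ring"
  assumes "singletons_group_bounded TYPE('a)"
    and "singletons_group_bounded TYPE('b)"
    and "AM_property TYPE('a)"
    and "Levi_property TYPE('a)"
    and "additive T"
    and "order_bounded_map T"
  shows "br_bounded T"
  unfolding br_bounded_def
  using assms(6) ring_bounded_imp_order_bounded[OF assms(3,4)] order_bounded_imp_ring_bounded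
  unfolding order_bounded_map_def by blast

end
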